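(* Let $E$ be a normed space, let $f\colon E\to E$, and let $p,q\in[1,+\infty)$. Assume that the composition operator $C_f$ maps $l^p(E)$ into $bv_q(E)$. Then $C_f\colon l^p(E)\to bv_q(E)$ is uniformly continuous if and only if $f$ is locally Hölder continuous in the stronger sense with exponent $\frac pq$, that is, there exist $\delta>0$ and $L\ge0$ such that $\|f(u)-f(w)\|\le L\|u-w\|^{\frac pq}$ for all $u,w\in E$ with $\|u-w\|\le\delta$.
   Context: $E$ is a normed space over $\mathbb R$ or $\mathbb C$ with norm $\|\cdot\|$. For a map $f\colon E\to E$, the composition operator $C_f$ assigns to a sequence $x\colon\mathbb N\to E$ the sequence $C_f(x)$ with $C_f(x)(n)=f(x(n))$ for all $n\in\mathbb N$. $l^p(E)$ is the space of sequences $x\colon\mathbb N\to E$ with $\|x\|_{l^p}=\bigl(\sum_{n=1}^\infty\|x(n)\|^p\bigr)^{1/p}<+\infty$. $bv_q(E)$ is the space of all sequences $x\colon\mathbb N\to E$ with $\sum_{n=1}^\infty\|x(n+1)-x(n)\|^q<+\infty$, with norm $\|x\|_{bv_q}=\|x(1)\|+\bigl(\sum_{n=1}^\infty\|x(n+1)-x(n)\|^q\bigr)^{1/q}$. The exponent $\frac pq$ is allowed to exceed $1$. *)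

theory Defs
  imports "HOL-Analysis.Analysis"
begin

text \<open>
  Sequences are functions on \<^typ>\<open>nat\<close>, so the index starts at \<open>0\<close>:  \<open>x 0\<close> plays the role of
  the first term. A complex normed space is covered by \<^class>\<open>real_normed_vector\<close> through
  restriction of scalars, as only the norm and subtraction occur.
\<close>

definition lp_space :: "real \<Rightarrow> (nat \<Rightarrow> 'a::real_normed_vector) set" where
  "lp_space p = {x. summable (\<lambda>n. norm (x n) powr p)}"

definition lp_norm :: "real \<Rightarrow> (nat \<Rightarrow> 'a::real_normed_vector) \<Rightarrow> real" where
  "lp_norm p x = (\<Sum>n. norm (x n) powr p) powr (1 / p)"

definition bv_space :: "real \<Rightarrow> (nat \<Rightarrow> 'a::real_normed_vector) set" where
  "bv_space q = {x. summable (\<lambda>n. norm (x (Suc n) - x n) powr q)}"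

definition bv_norm :: "real \<Rightarrow> (nat \<Rightarrow> 'a::real_normed_vector) \<Rightarrow> real" where
  "bv_norm q x = norm (x 0) + (\<Sum>n. norm (x (Suc n) - x n) powr q) powr (1 / q)"

text \<open>
  The conversion \<^const>\<open>metric\<close> is meaningful only for genuine metrics; see
  \<open>Metric_space_lp\<close> and \<open>Metric_space_bv\<close> below.
\<close>

definition lp_metric :: "real \<Rightarrow> (nat \<Rightarrow> 'a::real_normed_vector) metric" where
  "lp_metric p = metric (lp_space p, \<lambda>x y. lp_norm p (\<lambda>n. x n - y n))"

definition bv_metric :: "real \<Rightarrow> (nat \<Rightarrow> 'a::real_normed_vector) metric" where
  "bv_metric q = metric (bv_space q, \<lambda>x y. bv_norm q (\<lambda>n. x n - y n))"

definition composition_operator :: "('a \<Rightarrow> 'a) \<Rightarrow> (nat \<Rightarrow> 'a) \<Rightarrow> nat \<Rightarrow> 'a" where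
  "composition_operator f x = (\<lambda>n. f (x n))"

definition locally_Holder_stronger :: "real \<Rightarrow> ('a::real_normed_vector \<Rightarrow> 'a) \<Rightarrow> bool" where
  "locally_Holder_stronger \<alpha> f \<longleftrightarrow>
     (\<exists>\<delta>>0. \<exists>L\<ge>0. \<forall>u w. norm (u - w) \<le> \<delta> \<longrightarrow> norm (f u - f w) \<le> L * norm (u - w) powr \<alpha>)"

lemma powr_convex_comb:
  fixes s t l p :: real
  assumes "p \<ge> 1" "s \<ge> 0" "t \<ge> 0" "0 \<le> l" "l \<le> 1"
  shows "((1 - l) * s + l * t) powr p \<le> (1 - l) * s powr p + l * t powr p"
proof -
  have small: "(c * z) powr p \<le> c * z powr p" if "0 \<le> c" "c \<le> 1" "z \<ge> 0" for c z :: real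
  proof -
    have "c powr p \<le> c"
      using that assms(1) powr_mono'[of 1 p c] by (cases "c = 0") auto
    then show ?thesis
      using that by (simp add: powr_mult mult_right_mono)
  qed
  consider "s = 0" | "t = 0" | "s > 0" "t > 0" using assms by linarith
  then show ?thesis
  proof cases
    case 1
    then show ?thesis using small[of l t] assms by simp
  next
    case 2
    then show ?thesis using small[of "1 - l" s] assms by simp
  next
    case 3
    then show ?thesis using convex_onD[OF powr_convex[OF assms(1)], of l s t] assms by simp
  qed
qed

lemma Minkowski_series:
  fixes a b :: "nat \<Rightarrow> real"
  assumes p: "p \<ge> 1" and a: "\<And>n. a n \<ge> 0" and b: "\<And>n. b n \<ge> 0"
    and sa: "summable (\<lambda>n. a n powr p)" and sb: "summable (\<lambda>n. b n powr p)"
  shows "summable (\<lambda>n. (a n + b n) powr p)"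
    and "(\<Sum>n. (a n + b n) powr p) powr (1/p)
           \<le> (\<Sum>n. a n powr p) powr (1/p) + (\<Sum>n. b n powr p) powr (1/p)"
proof -
  define A where "A = (\<Sum>n. a n powr p) powr (1/p)"
  define B where "B = (\<Sum>n. b n powr p) powr (1/p)"
  have A0: "A \<ge> 0" and B0: "B \<ge> 0" by (auto simp: A_def B_def)
  have nna: "(\<Sum>n. a n powr p) \<ge> 0" and nnb: "(\<Sum>n. b n powr p) \<ge> 0"
    using sa sb by (auto intro: suminf_nonneg)
  have Ap: "A powr p = (\<Sum>n. a n powr p)" and Bp: "B powr p = (\<Sum>n. b n powr p)"
    using nna nnb p by (auto simp: A_def B_def powr_powr)
  have "summable (\<lambda>n. (a n + b n) powr p) \<and> (\<Sum>n. (a n + b n) powr p) powr (1/p) \<le> A + B"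
  proof (cases "A = 0 \<or> B = 0")
    case True
    then show ?thesis
    proof
      assume "A = 0"
      then have "(\<Sum>n. a n powr p) = 0" using Ap by simp
      then have "a n = 0" for n using suminf_eq_zero_iff[OF sa] by simp
      then show ?thesis using sb A0 by (simp add: B_def)
    next
      assume "B = 0"
      then have "(\<Sum>n. b n powr p) = 0" using Bp by simp
      then have "b n = 0" for n using suminf_eq_zero_iff[OF sb] by simp
      then show ?thesis using sa B0 by (simp add: A_def)
    qed
  next
    case False
    then have AB: "A > 0" "B > 0" using A0 B0 by auto
    define l where "l = B / (A + B)"
    have l: "0 \<le> l" "l \<le> 1" and l1: "1 - l = A / (A + B)"
      using AB by (auto simp: l_def field_simps)
    define g where "g n = (A+B) powr p * ((1 - l) * (a n powr p / A powr p) + l * (b n powr p / B powr p))" for n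
    have bound: "(a n + b n) powr p \<le> g n" for n
    proof -
      have "a n + b n = (A + B) * ((1 - l) * (a n / A) + l * (b n / B))"
      proof -
        have "(A + B) * (1 - l) = A" "(A + B) * l = B"
          unfolding l1 using AB by (simp_all add: l_def)
        moreover have "(A + B) * ((1 - l) * (a n / A) + l * (b n / B))
            = ((A + B) * (1 - l)) * (a n / A) + ((A + B) * l) * (b n / B)"
          by (simp only: distrib_left mult.assoc)
        ultimately show ?thesis using AB by simp
      qed
      then have "(a n + b n) powr p = (A + B) powr p * ((1 - l) * (a n / A) + l * (b n / B)) powr p"
        using AB a b l by (simp add: powr_mult)
      also have "\<dots> \<le> (A + B) powr p * ((1 - l) * (a n / A) powr p + l * (b n / B) powr p)"
        using powr_convex_comb[OF p _ _ l, of "a n / A" "b n / B"] AB a b by (intro mult_left_mono) auto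
      also have "\<dots> = g n"
        unfolding g_def using AB a b by (simp add: powr_divide)
      finally show ?thesis .
    qed
    have "g sums ((A+B) powr p * ((1 - l) * (A powr p / A powr p) + l * (B powr p / B powr p)))"
      unfolding g_def
      by (intro sums_mult sums_add sums_divide) (use sa sb Ap Bp summable_sums in force)+
    then have g: "g sums ((A+B) powr p)" using AB by simp
    have summ: "summable (\<lambda>n. (a n + b n) powr p)"
      by (rule summable_comparison_test'[OF sums_summable[OF g], of 0]) (use bound in simp)
    have "(\<Sum>n. (a n + b n) powr p) \<le> (A+B) powr p"
      using suminf_le[OF bound summ sums_summable[OF g]] sums_unique[OF g] by simp
    then have "(\<Sum>n. (a n + b n) powr p) powr (1/p) \<le> ((A+B) powr p) powr (1/p)"
      using summ p by (intro powr_mono2) (auto intro: suminf_nonneg)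
    also have "\<dots> = A + B" using AB p by (simp add: powr_powr)
    finally show ?thesis using summ by simp
  qed
  then show "summable (\<lambda>n. (a n + b n) powr p)"
    and "(\<Sum>n. (a n + b n) powr p) powr (1/p)
           \<le> (\<Sum>n. a n powr p) powr (1/p) + (\<Sum>n. b n powr p) powr (1/p)"
    by (auto simp: A_def B_def)
qed

lemma lp_add:
  fixes x y :: "nat \<Rightarrow> 'a::real_normed_vector"
  assumes p: "p \<ge> 1" and x: "x \<in> lp_space p" and y: "y \<in> lp_space p"
  shows "(\<lambda>n. x n + y n) \<in> lp_space p"
    and "lp_norm p (\<lambda>n. x n + y n) \<le> lp_norm p x + lp_norm p y"
proof -
  note M = Minkowski_series[OF p, of "\<lambda>n. norm (x n)" "\<lambda>n. norm (y n)"]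
  have s: "summable (\<lambda>n. (norm (x n) + norm (y n)) powr p)"
    using M(1) x y by (simp add: lp_space_def)
  have le: "norm (x n + y n) powr p \<le> (norm (x n) + norm (y n)) powr p" for n
    using p by (intro powr_mono2 norm_triangle_ineq) auto
  have s': "summable (\<lambda>n. norm (x n + y n) powr p)"
    by (rule summable_comparison_test'[OF s, of 0]) (use le in simp)
  then show "(\<lambda>n. x n + y n) \<in> lp_space p" by (simp add: lp_space_def)
  have "(\<Sum>n. norm (x n + y n) powr p) powr (1/p) \<le> (\<Sum>n. (norm (x n) + norm (y n)) powr p) powr (1/p)"
    using p s' by (intro powr_mono2 suminf_le le s s') (auto intro: suminf_nonneg)
  then show "lp_norm p (\<lambda>n. x n + y n) \<le> lp_norm p x + lp_norm p y"
    using M(2) x y by (simp add: lp_space_def lp_norm_def)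
qed

lemma lp_minus_commute: "lp_norm p (\<lambda>n. x n - y n) = lp_norm p (\<lambda>n. y n - x n)"
  by (simp add: lp_norm_def norm_minus_commute)

lemma lp_diff:
  assumes "p \<ge> 1" "x \<in> lp_space p" "y \<in> lp_space p"
  shows "(\<lambda>n. x n - y n) \<in> lp_space p"
  using lp_add(1)[of p x "\<lambda>n. - y n"] assms by (simp add: lp_space_def)

lemma lp_norm_eq_0:
  assumes "x \<in> lp_space p"
  shows "lp_norm p x = 0 \<longleftrightarrow> (\<forall>n. x n = 0)"
  using suminf_eq_zero_iff[of "\<lambda>n. norm (x n) powr p"] assms
  by (simp add: lp_space_def lp_norm_def)

lemma lp_triangle:
  assumes "p \<ge> 1" "x \<in> lp_space p" "y \<in> lp_space p" "z \<in> lp_space p"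
  shows "lp_norm p (\<lambda>n. x n - z n) \<le> lp_norm p (\<lambda>n. x n - y n) + lp_norm p (\<lambda>n. y n - z n)"
  using lp_add(2)[OF assms(1) lp_diff[OF assms(1-3)] lp_diff[OF assms(1,3,4)]] by simp

lemma Metric_space_lp:
  assumes "p \<ge> 1"
  shows "Metric_space (lp_space p) (\<lambda>x y. lp_norm p (\<lambda>n. x n - y n))"
proof
  show "lp_norm p (\<lambda>n. x n - y n) = 0 \<longleftrightarrow> x = y"
    if "x \<in> lp_space p" "y \<in> lp_space p" for x y :: "nat \<Rightarrow> 'a"
    using lp_norm_eq_0[OF lp_diff[OF assms that]] by (auto simp: fun_eq_iff)
qed (use assms lp_triangle lp_minus_commute in \<open>auto simp: lp_norm_def\<close>)

lemma bv_space_iff_lp: "x \<in> bv_space q \<longleftrightarrow> (\<lambda>n. x (Suc n) - x n) \<in> lp_space q"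
  by (simp add: bv_space_def lp_space_def)

lemma bv_norm_diff_lp:
  "bv_norm q (\<lambda>n. x n - y n) =
     norm (x 0 - y 0) + lp_norm q (\<lambda>n. (x (Suc n) - x n) - (y (Suc n) - y n))"
  by (simp add: bv_norm_def lp_norm_def algebra_simps)

lemma Metric_space_bv:
  assumes "q \<ge> 1"
  shows "Metric_space (bv_space q) (\<lambda>x y. bv_norm q (\<lambda>n. x n - y n))"
proof
  show "bv_norm q (\<lambda>n. x n - y n) \<ge> 0" for x y :: "nat \<Rightarrow> 'a"
    by (simp add: bv_norm_def)
  show "bv_norm q (\<lambda>n. x n - y n) = bv_norm q (\<lambda>n. y n - x n)" for x y :: "nat \<Rightarrow> 'a"
    unfolding bv_norm_diff_lp
    by (subst lp_minus_commute) (simp add: norm_minus_commute)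
next
  fix x y :: "nat \<Rightarrow> 'a"
  assume xy: "x \<in> bv_space q" "y \<in> bv_space q"
  have nn: "lp_norm q z \<ge> 0" for z :: "nat \<Rightarrow> 'a" by (simp add: lp_norm_def)
  show "bv_norm q (\<lambda>n. x n - y n) = 0 \<longleftrightarrow> x = y"
  proof
    assume "bv_norm q (\<lambda>n. x n - y n) = 0"
    then have x0: "x 0 = y 0" and "lp_norm q (\<lambda>n. (x (Suc n) - x n) - (y (Suc n) - y n)) = 0"
      unfolding bv_norm_diff_lp by (simp_all add: add_nonneg_eq_0_iff nn)
    then have step: "x (Suc n) - x n = y (Suc n) - y n" for n
      using lp_norm_eq_0[OF lp_diff[OF assms xy[unfolded bv_space_iff_lp]]] by simp
    have "x n = y n" for n
    proof (induction n)
      case (Suc n)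
      then show ?case using step[of n] by simp
    qed (rule x0)
    then show "x = y" by auto
  qed (simp add: bv_norm_def)
next
  fix x y z :: "nat \<Rightarrow> 'a"
  assume xyz: "x \<in> bv_space q" "y \<in> bv_space q" "z \<in> bv_space q"
  show "bv_norm q (\<lambda>n. x n - z n) \<le> bv_norm q (\<lambda>n. x n - y n) + bv_norm q (\<lambda>n. y n - z n)"
    using lp_triangle[OF assms xyz[unfolded bv_space_iff_lp]]
      norm_triangle_ineq[of "x 0 - y 0" "y 0 - z 0"]
    by (simp add: bv_norm_diff_lp)
qed

lemma lp_metric_simps [simp]:
  assumes "p \<ge> 1"
  shows "mspace (lp_metric p) = lp_space p"
    and "mdist (lp_metric p) x y = lp_norm p (\<lambda>n. x n - y n)"
  by (simp_all add: lp_metric_def Metric_space.mspace_metric[OF Metric_space_lp[OF assms]]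
      Metric_space.mdist_metric[OF Metric_space_lp[OF assms]])

lemma bv_metric_simps [simp]:
  assumes "q \<ge> 1"
  shows "mspace (bv_metric q) = bv_space q"
    and "mdist (bv_metric q) x y = bv_norm q (\<lambda>n. x n - y n)"
  by (simp_all add: bv_metric_def Metric_space.mspace_metric[OF Metric_space_bv[OF assms]]
      Metric_space.mdist_metric[OF Metric_space_bv[OF assms]])

end

theory Submission
  imports Defs
begin

text \<open>
  If \<open>f\<close> is Hoelder with constant \<open>L\<close> and exponent \<open>p / q\<close> at distances up to \<open>\<delta>\<close>, then for
  \<open>\<parallel>x - y\<parallel> \<le> \<delta>\<close> in \<open>l\<^sup>p\<close> the sequence \<open>d = C\<^sub>f x - C\<^sub>f y\<close> satisfies
  \<open>\<parallel>d n\<parallel>\<^sup>q \<le> L\<^sup>q \<parallel>x n - y n\<parallel>\<^sup>p\<close>. Summing bounds the \<open>l\<^sup>q\<close> norm of \<open>d\<close>, and the \<open>bv\<^sub>q\<close> norm is at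
  most three times the \<open>l\<^sup>q\<close> norm.

  Conversely, the oscillating sequences \<open>(u, 0, u, 0, \<dots>)\<close> and \<open>(w, 0, w, 0, \<dots>)\<close>, cut off
  after \<open>M\<close> terms with \<open>M \<parallel>u - w\<parallel>\<^sup>p\<close> of the order of a fixed small constant, are close in \<open>l\<^sup>p\<close>,
  whereas the difference of their images jumps \<open>M\<close> times by \<open>f u - f w\<close>; hence
  \<open>M \<parallel>f u - f w\<parallel>\<^sup>q\<close> is bounded.
\<close>

section \<open>Comparison of the sequence norms\<close>

lemma norm_le_lp_norm:
  assumes "p \<ge> 1" "x \<in> lp_space p"
  shows "norm (x n) \<le> lp_norm p x"
proof -
  have "norm (x n) powr p \<le> (\<Sum>n. norm (x n) powr p)"
    using sum_le_suminf[of "\<lambda>n. norm (x n) powr p" "{n}"] assms(2) by (simp add: lp_space_def)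
  then have "(norm (x n) powr p) powr (1 / p) \<le> lp_norm p x"
    unfolding lp_norm_def using assms(1) by (intro powr_mono2) auto
  then show ?thesis
    using assms(1) by (simp add: powr_powr)
qed

lemma lp_norm_powr:
  assumes "p \<ge> 1" "x \<in> lp_space p"
  shows "lp_norm p x powr p = (\<Sum>n. norm (x n) powr p)"
  using assms suminf_nonneg[of "\<lambda>n. norm (x n) powr p"]
  by (simp add: lp_norm_def lp_space_def powr_powr)

lemma lp_Suc:
  assumes "p \<ge> 1" "x \<in> lp_space p"
  shows "(\<lambda>n. x (Suc n)) \<in> lp_space p"
    and "lp_norm p (\<lambda>n. x (Suc n)) \<le> lp_norm p x"
proof -
  have s: "summable (\<lambda>n. norm (x n) powr p)"
    using assms(2) by (simp add: lp_space_def)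
  then have s': "summable (\<lambda>n. norm (x (Suc n)) powr p)"
    by (subst summable_Suc_iff)
  then show "(\<lambda>n. x (Suc n)) \<in> lp_space p"
    by (simp add: lp_space_def)
  have "(\<Sum>n. norm (x (Suc n)) powr p) \<le> (\<Sum>n. norm (x n) powr p)"
    using suminf_split_head[OF s] by simp
  then show "lp_norm p (\<lambda>n. x (Suc n)) \<le> lp_norm p x"
    unfolding lp_norm_def using assms(1) suminf_nonneg[OF s'] by (intro powr_mono2) auto
qed

text \<open>The first entry, the shifted sequence and the sequence itself each contribute at most
  \<open>lp_norm q x\<close>; the last two arise from the triangle inequality for the
  increments.\<close>

lemma bv_norm_le_lp_norm:
  assumes "q \<ge> 1" "x \<in> lp_space q"
  shows "bv_norm q x \<le> 3 * lp_norm q x"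
proof -
  have "(\<lambda>n. - x n) \<in> lp_space q"
    using assms(2) by (simp add: lp_space_def)
  from lp_add(2)[OF assms(1) lp_Suc(1)[OF assms] this]
  have "lp_norm q (\<lambda>n. x (Suc n) - x n) \<le> lp_norm q (\<lambda>n. x (Suc n)) + lp_norm q x"
    by (simp add: lp_norm_def)
  moreover have "bv_norm q x = norm (x 0) + lp_norm q (\<lambda>n. x (Suc n) - x n)"
    by (simp add: bv_norm_def lp_norm_def)
  ultimately show ?thesis
    using norm_le_lp_norm[OF assms, of 0] lp_Suc(2)[OF assms] by linarith
qed

lemma bv_diff:
  assumes "q \<ge> 1" "x \<in> bv_space q" "y \<in> bv_space q"
  shows "(\<lambda>n. x n - y n) \<in> bv_space q"
  using lp_diff[OF assms(1) assms(2,3)[unfolded bv_space_iff_lp]]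
  by (simp add: bv_space_iff_lp algebra_simps)

section \<open>Oscillating test sequences\<close>

definition oscillation :: "nat \<Rightarrow> 'a::real_normed_vector \<Rightarrow> nat \<Rightarrow> 'a" where
  "oscillation M u n = (if even n \<and> n \<le> M then u else 0)"

lemma oscillation_diff:
  "(\<lambda>n. oscillation M u n - oscillation M w n) = oscillation M (u - w)"
  by (auto simp: oscillation_def)

text \<open>Wherever the oscillations vanish, both images equal \<open>f 0\<close>, which cancels in
  the difference whatever its value.\<close>

lemma composition_operator_oscillation_diff:
  "(\<lambda>n. composition_operator f (oscillation M u) n - composition_operator f (oscillation M w) n)
    = oscillation M (f u - f w)"
  by (auto simp: oscillation_def composition_operator_def)

lemma oscillation_in_lp_space: "oscillation M u \<in> lp_space p"
  unfolding lp_space_def mem_Collect_eq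
  by (rule summable_finite[of "{..M}"]) (auto simp: oscillation_def)

text \<open>The bound counts all indices up to \<open>M\<close> although only the even ones carry
  \<open>u\<close>; this costs only a constant factor.\<close>

lemma lp_norm_oscillation_le:
  assumes "p \<ge> 1"
  shows "lp_norm p (oscillation M u) powr p \<le> real (Suc M) * norm u powr p"
proof -
  have "lp_norm p (oscillation M u) powr p = (\<Sum>n. norm (oscillation M u n) powr p)"
    by (rule lp_norm_powr[OF assms oscillation_in_lp_space])
  also have "\<dots> = (\<Sum>n\<le>M. norm (oscillation M u n) powr p)"
    by (rule suminf_finite) (auto simp: oscillation_def)
  also have "\<dots> \<le> (\<Sum>n\<le>M. norm u powr p)"
    by (rule sum_mono) (simp add: oscillation_def)
  finally show ?thesis by simp
qed

text \<open>For \<open>n < M\<close> exactly one of \<open>n\<close> and \<open>Suc n\<close> is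
  even and both are at most \<open>M\<close>, so each of these \<open>M\<close> increments has norm
  \<open>norm v\<close>.\<close>

lemma bv_norm_oscillation_ge:
  assumes "q \<ge> 1" "oscillation M v \<in> bv_space q"
  shows "real M * norm v powr q \<le> bv_norm q (oscillation M v) powr q"
proof -
  define D where "D n = norm (oscillation M v (Suc n) - oscillation M v n) powr q" for n
  have s: "summable D"
    using assms(2) by (simp add: bv_space_def D_def[abs_def])
  have nn: "suminf D \<ge> 0"
    by (rule suminf_nonneg[OF s]) (simp add: D_def)
  have "D n = norm v powr q" if "n < M" for n
    using that by (simp add: D_def oscillation_def)
  then have "real M * norm v powr q = (\<Sum>n<M. D n)"
    by simp
  also have "\<dots> \<le> suminf D"
    by (rule sum_le_suminf[OF s]) (auto simp: D_def)
  also have "\<dots> = (suminf D powr (1 / q)) powr q"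
    using nn assms(1) by (simp add: powr_powr)
  also have "\<dots> \<le> bv_norm q (oscillation M v) powr q"
    using assms(1) by (intro powr_mono2) (auto simp: bv_norm_def D_def[abs_def])
  finally show ?thesis .
qed

section \<open>Sufficiency of the Hoelder condition\<close>

lemma composition_operator_Holder:
  fixes f :: "'a::real_normed_vector \<Rightarrow> 'a"
  assumes p: "p \<ge> 1" and q: "q \<ge> 1" and L: "L \<ge> 0"
    and Holder: "\<And>u w. norm (u - w) \<le> \<delta> \<Longrightarrow> norm (f u - f w) \<le> L * norm (u - w) powr (p / q)"
    and z: "(\<lambda>n. x n - y n) \<in> lp_space p" and le: "lp_norm p (\<lambda>n. x n - y n) \<le> \<delta>"
  shows "(\<lambda>n. f (x n) - f (y n)) \<in> lp_space q"
    and "lp_norm q (\<lambda>n. f (x n) - f (y n)) \<le> L * lp_norm p (\<lambda>n. x n - y n) powr (p / q)"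
proof -
  have s: "summable (\<lambda>n. L powr q * norm (x n - y n) powr p)"
    using z by (intro summable_mult) (simp add: lp_space_def)
  have bound: "norm (f (x n) - f (y n)) powr q \<le> L powr q * norm (x n - y n) powr p" for n
  proof -
    \<comment> \<open>Each entry is bounded by the norm of the sequence, so the local condition
      applies at every index.\<close>
    have "norm (x n - y n) \<le> \<delta>"
      using norm_le_lp_norm[OF p z, of n] le by simp
    then have "norm (f (x n) - f (y n)) powr q \<le> (L * norm (x n - y n) powr (p / q)) powr q"
      using q by (intro powr_mono2 Holder) auto
    then show ?thesis
      using q L by (simp add: powr_mult powr_powr)
  qed
  have s': "summable (\<lambda>n. norm (f (x n) - f (y n)) powr q)"
    by (rule summable_comparison_test'[OF s, of 0]) (use bound in simp)
  then show "(\<lambda>n. f (x n) - f (y n)) \<in> lp_space q"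
    by (simp add: lp_space_def)
  have "(\<Sum>n. norm (f (x n) - f (y n)) powr q) \<le> (\<Sum>n. L powr q * norm (x n - y n) powr p)"
    by (rule suminf_le[OF bound s' s])
  also have "\<dots> = L powr q * lp_norm p (\<lambda>n. x n - y n) powr p"
    using z by (simp add: lp_norm_powr[OF p z] lp_space_def suminf_mult)
  finally have "lp_norm q (\<lambda>n. f (x n) - f (y n))
      \<le> (L powr q * lp_norm p (\<lambda>n. x n - y n) powr p) powr (1 / q)"
    unfolding lp_norm_def[of q] using q suminf_nonneg[OF s'] by (intro powr_mono2) auto
  also have "\<dots> = L * lp_norm p (\<lambda>n. x n - y n) powr (p / q)"
    using q L by (simp add: powr_mult powr_powr)
  finally show "lp_norm q (\<lambda>n. f (x n) - f (y n)) \<le> L * lp_norm p (\<lambda>n. x n - y n) powr (p / q)" .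
qed

lemma Holder_imp_uniformly_continuous:
  fixes f :: "'a::real_normed_vector \<Rightarrow> 'a"
  assumes p: "p \<ge> 1" and q: "q \<ge> 1"
    and maps: "composition_operator f \<in> lp_space p \<rightarrow> bv_space q"
    and H: "locally_Holder_stronger (p / q) f"
  shows "uniformly_continuous_map (lp_metric p) (bv_metric q) (composition_operator f)"
proof -
  obtain \<delta> L where \<delta>: "\<delta> > 0" and L: "L \<ge> 0"
    and Holder: "\<And>u w. norm (u - w) \<le> \<delta> \<Longrightarrow> norm (f u - f w) \<le> L * norm (u - w) powr (p / q)"
    using H unfolding locally_Holder_stronger_def by blast
  have "\<exists>\<eta>>0. \<forall>x\<in>lp_space p. \<forall>y\<in>lp_space p. lp_norm p (\<lambda>n. y n - x n) < \<eta> \<longrightarrow>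
      bv_norm q (\<lambda>n. composition_operator f y n - composition_operator f x n) < \<epsilon>"
    if \<epsilon>: "\<epsilon> > 0" for \<epsilon>
  proof -
    \<comment> \<open>The second bound makes \<open>(3 * L + 1) * \<eta> powr (p / q)\<close> at
      most \<open>\<epsilon>\<close>. The summand \<open>1\<close> avoids division by zero when
      \<open>L = 0\<close> and makes the final inequality strict.\<close>
    define \<eta> where "\<eta> = min \<delta> ((\<epsilon> / (3 * L + 1)) powr (q / p))"
    have \<eta>: "\<eta> > 0" "\<eta> \<le> \<delta>"
      using \<delta> \<epsilon> L by (auto simp: \<eta>_def)
    have "\<eta> powr (p / q) \<le> ((\<epsilon> / (3 * L + 1)) powr (q / p)) powr (p / q)"
      using p q \<eta> by (intro powr_mono2) (auto simp: \<eta>_def)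
    also have "\<dots> = \<epsilon> / (3 * L + 1)"
      using p q \<epsilon> L by (simp add: powr_powr)
    finally have "(3 * L + 1) * \<eta> powr (p / q) \<le> \<epsilon>"
      using L by (simp add: field_simps)
    moreover have "\<eta> powr (p / q) > 0"
      using \<eta> by simp
    ultimately have small: "3 * L * \<eta> powr (p / q) < \<epsilon>"
      unfolding distrib_right by linarith
    have "bv_norm q (\<lambda>n. composition_operator f y n - composition_operator f x n) < \<epsilon>"
      if x: "x \<in> lp_space p" and y: "y \<in> lp_space p" and d: "lp_norm p (\<lambda>n. y n - x n) < \<eta>"
      for x y :: "nat \<Rightarrow> 'a"
    proof -
      have "lp_norm p (\<lambda>n. y n - x n) \<le> \<delta>"
        using d \<eta> by simp
      note C = composition_operator_Holder[OF p q L Holder lp_diff[OF p y x] this]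
      have "bv_norm q (\<lambda>n. f (y n) - f (x n)) \<le> 3 * lp_norm q (\<lambda>n. f (y n) - f (x n))"
        by (rule bv_norm_le_lp_norm[OF q C(1)])
      also have "\<dots> \<le> 3 * (L * lp_norm p (\<lambda>n. y n - x n) powr (p / q))"
        using C(2) by simp
      also have "\<dots> \<le> 3 * (L * \<eta> powr (p / q))"
        using d p q L by (intro mult_left_mono powr_mono2) (auto simp: lp_norm_def)
      finally show ?thesis
        using small by (simp add: composition_operator_def)
    qed
    then show ?thesis
      using \<eta>(1) by blast
  qed
  then show ?thesis
    using maps p q by (simp add: uniformly_continuous_map_def)
qed

section \<open>Necessity of the Hoelder condition\<close>

lemma uniformly_continuous_imp_Holder:
  fixes f :: "'a::real_normed_vector \<Rightarrow> 'a"
  assumes p: "p \<ge> 1" and q: "q \<ge> 1"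
    and uc: "uniformly_continuous_map (lp_metric p) (bv_metric q) (composition_operator f)"
  shows "locally_Holder_stronger (p / q) f"
proof -
  have maps: "composition_operator f \<in> lp_space p \<rightarrow> bv_space q"
    using uc p q by (simp add: uniformly_continuous_map_def)
  \<comment> \<open>The single tolerance \<open>1\<close> suffices, since the length
    \<open>M\<close> will be adapted to \<open>norm (u - w)\<close>.\<close>
  obtain \<eta> where \<eta>: "\<eta> > 0"
    and close: "\<And>x y. \<lbrakk>x \<in> lp_space p; y \<in> lp_space p; lp_norm p (\<lambda>n. y n - x n) < \<eta>\<rbrakk> \<Longrightarrow>
      bv_norm q (\<lambda>n. composition_operator f y n - composition_operator f x n) < 1"
    using uc p q unfolding uniformly_continuous_map_def
    by (simp) (metis zero_less_one)
  \<comment> \<open>The factor 3 leaves room for the bound \<open>2 * c < \<eta> powr p\<close>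
    below.\<close>
  define c where "c = \<eta> powr p / 3"
  have c: "c > 0"
    using \<eta> by (simp add: c_def)
  have "norm (f u - f w) \<le> (2 / c) powr (1 / q) * norm (u - w) powr (p / q)"
    if le: "norm (u - w) \<le> c powr (1 / p)" for u w
  proof (cases "u = w")
    case False
    define t where "t = norm (u - w) powr p"
    have t: "t > 0"
      using False by (simp add: t_def)
    have "t \<le> (c powr (1 / p)) powr p"
      unfolding t_def using le p by (intro powr_mono2) auto
    then have tc: "t \<le> c"
      using c p by (simp add: powr_powr)
    \<comment> \<open>This is the largest \<open>M\<close> with \<open>M * t \<le> c\<close>, which
      keeps the oscillations close. As \<open>t \<le> c\<close>, it is at least 1, so that
      \<open>c / t < M + 1 \<le> 2 * M\<close>.\<close>
    define M where "M = nat \<lfloor>c / t\<rfloor>"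
    have ct: "1 \<le> c / t"
      using tc t by simp
    have M1: "real M \<le> c / t" and M2: "c / t < real M + 1"
      using ct by (simp_all add: M_def)
    have "M \<ge> 1"
      using ct by (simp add: M_def le_nat_iff)
    then have M3: "c / t \<le> 2 * real M"
      using M2 by linarith
    have "lp_norm p (oscillation M (u - w)) powr p \<le> real (Suc M) * t"
      unfolding t_def by (rule lp_norm_oscillation_le[OF p])
    also have "\<dots> \<le> 2 * c"
      using M1 t tc by (simp add: field_simps)
    also have "\<dots> < \<eta> powr p"
      using \<eta> by (simp add: c_def)
    finally have "lp_norm p (oscillation M (u - w)) < \<eta>"
      using \<eta> p powr_mono2[of p \<eta> "lp_norm p (oscillation M (u - w))"] by (force simp: not_le)
    then have lt: "bv_norm q (oscillation M (f u - f w)) < 1"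
      using close[OF oscillation_in_lp_space[of M w] oscillation_in_lp_space[of M u]]
      by (simp add: oscillation_diff composition_operator_oscillation_diff)
    have "oscillation M (f u - f w) \<in> bv_space q"
      using bv_diff[OF q funcset_mem[OF maps oscillation_in_lp_space]
          funcset_mem[OF maps oscillation_in_lp_space], of M u M w]
      by (simp add: composition_operator_oscillation_diff)
    from bv_norm_oscillation_ge[OF q this]
    have "real M * norm (f u - f w) powr q \<le> bv_norm q (oscillation M (f u - f w)) powr q" .
    also have "\<dots> \<le> 1"
      using lt q powr_mono2[of q "bv_norm q (oscillation M (f u - f w))" 1]
      by (simp add: bv_norm_def)
    finally have "real M * norm (f u - f w) powr q \<le> 1" .
    moreover have "c / t * norm (f u - f w) powr q \<le> 2 * real M * norm (f u - f w) powr q"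
      using M3 by (intro mult_right_mono) auto
    ultimately have "c / t * norm (f u - f w) powr q \<le> 2"
      by linarith
    \<comment> \<open>The bound is linear in \<open>t = norm (u - w) powr p\<close>, so the
      \<open>q\<close>-th root yields the exponent \<open>p / q\<close>.\<close>
    then have "norm (f u - f w) powr q \<le> 2 / c * t"
      using c t by (simp add: field_simps)
    then have "(norm (f u - f w) powr q) powr (1 / q) \<le> (2 / c * t) powr (1 / q)"
      using q by (intro powr_mono2) auto
    then have "norm (f u - f w) \<le> (2 / c * t) powr (1 / q)"
      using q by (simp add: powr_powr)
    also have "\<dots> = (2 / c) powr (1 / q) * t powr (1 / q)"
      using c t by (intro powr_mult)
    finally show ?thesis
      by (simp add: t_def powr_powr)
  qed simp
  then show ?thesis
    unfolding locally_Holder_stronger_def using c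
    by (intro exI[of _ "c powr (1 / p)"] exI[of _ "(2 / c) powr (1 / q)"] conjI) auto
qed

theorem theorem25:
  fixes f :: "'a::real_normed_vector \<Rightarrow> 'a" and p q :: real
  assumes "1 \<le> p" and "1 \<le> q"
    and "composition_operator f \<in> lp_space p \<rightarrow> bv_space q"
  shows "uniformly_continuous_map (lp_metric p) (bv_metric q) (composition_operator f)
    \<longleftrightarrow> locally_Holder_stronger (p / q) f"
  using Holder_imp_uniformly_continuous[OF assms] uniformly_continuous_imp_Holder[OF assms(1,2)]
  by blast

end
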